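(* Let $D$ be a division algebra and let $n\ge 0$. For every proper two-sided ideal $I$ of the polynomial ring $D[t_1,\ldots,t_n]$ in $n$ central commuting variables over $D$, the quotient ring $S=D[t_1,\ldots,t_n]/I$ (which contains $D$ via $r\mapsto r+I$) is centrally normalizable over $D$. Equivalently, the tuple $(\mathrm{id}_D,\ldots,\mathrm{id}_D)$ is centrally normalizable over $D$.
   Context: All rings are associative with unity. A ring $S$ containing a division algebra $D$ is finite over a subring $R$ if $S$ is finitely generated as a left $R$-module. Elements $a_1,\ldots,a_m$ of $S$ centralize $D$ if $a_ib=ba_i$ for all $b\in D$. Commuting elements $a_1,\ldots,a_m\in S$ are (left) algebraically independent over $D$ if the monomials $a_1^{i_1}\cdots a_m^{i_m}$, $(i_1,\ldots,i_m)\in\mathbb{Z}_{\ge0}^m$, are left linearly independent over $D$. $S$ is centrally normalizable over $D$ if there exist $m\ge 0$ and commuting elements $a_1,\ldots,a_m\in S$ which centralize $D$, are left algebraically independent over $D$, and such that $S$ is finite (as a left module) over the subring $D[a_1,\ldots,a_m]$ generated by $D\cup\{a_1,\ldots,a_m\}$. A tuple of automorphisms is centrally normalizable over $D$ if every quotient of the corresponding skew polynomial ring by a proper two-sided ideal is centrally normalizable over $D$. *)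

theory Defs
  imports "HOL-Algebra.Algebra" "HOL-Library.Poly_Mapping"
begin

text \<open>Polynomials are finitely supported maps from monomials (exponent vectors,
  themselves finitely supported maps nat =>0 nat) to coefficients in D; the
  library multiplication is the convolution (p*q)(k) = sum over a+b=k of p a * q b,
  i.e. the variables are central and commute with each other.  The ring in n
  variables consists of those polynomials whose monomials only involve the
  variables with index < n.\<close>

definition poly_ring_n :: "nat \<Rightarrow> ((nat \<Rightarrow>\<^sub>0 nat) \<Rightarrow>\<^sub>0 'd::division_ring) ring" where
  "poly_ring_n n = \<lparr> carrier = {p. \<forall>m \<in> Poly_Mapping.keys p. Poly_Mapping.keys m \<subseteq> {..<n}},
                     monoid.mult = (*), one = 1, ring.zero = 0, ring.add = (+) \<rparr>"

definition const_poly :: "'d::division_ring \<Rightarrow> (nat \<Rightarrow>\<^sub>0 nat) \<Rightarrow>\<^sub>0 'd" where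
  "const_poly d = Poly_Mapping.single 0 d"

primrec mono_prod :: "('a, 'b) ring_scheme \<Rightarrow> (nat \<Rightarrow> 'a) \<Rightarrow> nat \<Rightarrow> (nat \<Rightarrow> nat) \<Rightarrow> 'a" where
  "mono_prod S a 0 e = \<one>\<^bsub>S\<^esub>"
| "mono_prod S a (Suc k) e = mono_prod S a k e \<otimes>\<^bsub>S\<^esub> (a k [^]\<^bsub>S\<^esub> e k)"

definition left_alg_indep ::
    "('a, 'b) ring_scheme \<Rightarrow> ('d::division_ring \<Rightarrow> 'a) \<Rightarrow> nat \<Rightarrow> (nat \<Rightarrow> 'a) \<Rightarrow> bool" where
  "left_alg_indep S \<iota> m a \<longleftrightarrow>
     (\<forall>F c. finite F \<and> F \<subseteq> {e. \<forall>i\<ge>m. e i = 0} \<and>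
        finsum S (\<lambda>e. \<iota> (c e) \<otimes>\<^bsub>S\<^esub> mono_prod S a m e) F = \<zero>\<^bsub>S\<^esub>
        \<longrightarrow> (\<forall>e\<in>F. c e = 0))"

definition finite_left_over :: "('a, 'b) ring_scheme \<Rightarrow> 'a set \<Rightarrow> bool" where
  "finite_left_over S T \<longleftrightarrow>
     (\<exists>B. finite B \<and> B \<subseteq> carrier S \<and>
        (\<forall>s\<in>carrier S. \<exists>r. r \<in> B \<rightarrow> T \<and> s = finsum S (\<lambda>b. r b \<otimes>\<^bsub>S\<^esub> b) B))"

definition centrally_normalizable ::
    "('a, 'b) ring_scheme \<Rightarrow> ('d::division_ring \<Rightarrow> 'a) \<Rightarrow> bool" where
  "centrally_normalizable S \<iota> \<longleftrightarrow>
     (\<exists>m a. (\<forall>i<m. a i \<in> carrier S)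
        \<and> (\<forall>i<m. \<forall>j<m. a i \<otimes>\<^bsub>S\<^esub> a j = a j \<otimes>\<^bsub>S\<^esub> a i)
        \<and> (\<forall>i<m. \<forall>d. a i \<otimes>\<^bsub>S\<^esub> \<iota> d = \<iota> d \<otimes>\<^bsub>S\<^esub> a i)
        \<and> left_alg_indep S \<iota> m a
        \<and> finite_left_over S (generate_ring S (range \<iota> \<union> a ` {..<m})))"

end

theory Submission
  imports Defs
begin

text \<open>Nagata's proof of Noether normalization works verbatim over a division ring as long as the
  generators commute with each other and centralize \<open>D\<close>: the new generators of the substitution
  are differences of such elements, and a relation can be made monic by dividing by its top
  coefficient on the left.  Hence no description of the two-sided ideals is needed.\<close>

section \<open>Left spans\<close>

text \<open>Coefficients are indexed by the generators themselves, in the shape of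
  \<open>finite_left_over\<close>. For infinite \<open>B\<close> the sum \<open>finsum\<close> is
  \<open>\<zero>\<close> by convention, so the notion is meaningful for finite
  \<open>B\<close>.\<close>

definition lspan :: "('a, 'b) ring_scheme \<Rightarrow> 'a set \<Rightarrow> 'a set \<Rightarrow> 'a set" where
  "lspan R T B = {finsum R (\<lambda>b. r b \<otimes>\<^bsub>R\<^esub> b) B | r. r \<in> B \<rightarrow> T}"

lemma finite_left_over_iff_lspan:
  "finite_left_over R T \<longleftrightarrow> (\<exists>B. finite B \<and> B \<subseteq> carrier R \<and> carrier R \<subseteq> lspan R T B)"
proof -
  have "s \<in> lspan R T B \<longleftrightarrow> (\<exists>r. r \<in> B \<rightarrow> T \<and> s = finsum R (\<lambda>b. r b \<otimes>\<^bsub>R\<^esub> b) B)" for s B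
    by (auto simp: lspan_def)
  then show ?thesis by (simp only: finite_left_over_def subset_iff Ball_def)
qed

context ring
begin

lemma finsum_in_closed_set:
  assumes "finite A" "f \<in> A \<rightarrow> M" "M \<subseteq> carrier R" "\<zero> \<in> M"
    and "\<And>x y. x \<in> M \<Longrightarrow> y \<in> M \<Longrightarrow> x \<oplus> y \<in> M"
  shows "finsum R f A \<in> M"
  using assms(1,2)
proof (induction A rule: finite_induct)
  case empty
  then show ?case using assms(4) by simp
next
  case (insert a A)
  then have "f \<in> A \<rightarrow> carrier R" "f a \<in> carrier R" "f \<in> A \<rightarrow> M" "f a \<in> M"
    using assms(3) by auto
  then show ?case using insert assms(5) by simp
qed

text \<open>Serves as the induction principle for spans: a property is proved on all of
  \<open>lspan R T B\<close> by letting \<open>M\<close> be the set of elements that have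
  it.\<close>

lemma lspan_minimal:
  assumes "finite B" "M \<subseteq> carrier R" "\<zero> \<in> M"
    and "\<And>x y. x \<in> M \<Longrightarrow> y \<in> M \<Longrightarrow> x \<oplus> y \<in> M"
    and "\<And>t b. t \<in> T \<Longrightarrow> b \<in> B \<Longrightarrow> t \<otimes> b \<in> M"
  shows "lspan R T B \<subseteq> M"
proof
  fix x assume "x \<in> lspan R T B"
  then obtain r where r: "r \<in> B \<rightarrow> T" "x = finsum R (\<lambda>b. r b \<otimes> b) B"
    unfolding lspan_def by blast
  show "x \<in> M"
    unfolding r(2) by (rule finsum_in_closed_set[OF assms(1) _ assms(2-4)]) (use r(1) assms(5) in auto)
qed

section \<open>Left spans over a subring as left modules\<close>

context
  fixes T B
  assumes T: "subring T R" and B: "B \<subseteq> carrier R"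
begin

lemma lspan_carrier: "lspan R T B \<subseteq> carrier R"
  using B subringE(1)[OF T] unfolding lspan_def by (fastforce intro!: finsum_closed)

lemma lspan_zero: "\<zero> \<in> lspan R T B"
proof -
  have "(\<Oplus>b\<in>B. \<zero> \<otimes> b) = (\<Oplus>b\<in>B. \<zero>)"
    using B by (intro finsum_cong) (auto simp: simp_implies_def)
  then show ?thesis
    unfolding lspan_def using subringE(2)[OF T] by (force intro!: exI[of _ "\<lambda>_. \<zero>"])
qed

lemma lspan_add:
  assumes "x \<in> lspan R T B" "y \<in> lspan R T B"
  shows "x \<oplus> y \<in> lspan R T B"
proof -
  obtain r s where r: "r \<in> B \<rightarrow> T" "x = finsum R (\<lambda>b. r b \<otimes> b) B"
    and s: "s \<in> B \<rightarrow> T" "y = finsum R (\<lambda>b. s b \<otimes> b) B"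
    using assms unfolding lspan_def by blast
  have c: "r b \<in> carrier R" "s b \<in> carrier R" "b \<in> carrier R" if "b \<in> B" for b
    using that r(1) s(1) B subringE(1)[OF T] by auto
  have "(\<Oplus>b\<in>B. (r b \<oplus> s b) \<otimes> b) = (\<Oplus>b\<in>B. r b \<otimes> b \<oplus> s b \<otimes> b)"
    by (intro finsum_cong) (auto simp: simp_implies_def l_distr c)
  also have "\<dots> = x \<oplus> y"
    unfolding r(2) s(2) by (rule finsum_addf) (auto simp: c)
  finally show ?thesis
    unfolding lspan_def using r(1) s(1) subringE(7)[OF T]
    by (force intro!: exI[of _ "\<lambda>b. r b \<oplus> s b"])
qed

lemma lspan_smult:
  assumes "t \<in> T" "x \<in> lspan R T B"
  shows "t \<otimes> x \<in> lspan R T B"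
proof (cases "finite B")
  case True
  obtain r where r: "r \<in> B \<rightarrow> T" "x = finsum R (\<lambda>b. r b \<otimes> b) B"
    using assms unfolding lspan_def by blast
  have c: "r b \<in> carrier R" "b \<in> carrier R" if "b \<in> B" for b
    using that r(1) B subringE(1)[OF T] by auto
  have t: "t \<in> carrier R" using assms(1) subringE(1)[OF T] by auto
  have "t \<otimes> x = (\<Oplus>b\<in>B. t \<otimes> (r b \<otimes> b))"
    unfolding r(2) by (rule finsum_rdistr) (auto simp: c t True)
  also have "\<dots> = (\<Oplus>b\<in>B. (t \<otimes> r b) \<otimes> b)"
    by (intro finsum_cong) (auto simp: simp_implies_def m_assoc c t)
  finally show ?thesis
    unfolding lspan_def using r(1) assms(1) subringE(6)[OF T]
    by (force intro!: exI[of _ "\<lambda>b. t \<otimes> r b"])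
next
  case False
  \<comment> \<open>A sum over an infinite set has the default value \<open>\<zero>\<close>.\<close>
  then have "x = \<zero>" using assms(2) by (auto simp: lspan_def)
  then show ?thesis using lspan_zero assms(1) subringE(1)[OF T] by auto
qed

lemma lspan_neg:
  assumes "x \<in> lspan R T B" shows "\<ominus> x \<in> lspan R T B"
proof -
  have "\<ominus> x = (\<ominus> \<one>) \<otimes> x" using assms lspan_carrier by (auto simp: l_minus)
  then show ?thesis using lspan_smult[OF _ assms] subringE(3,5)[OF T] by simp
qed

lemma lspan_incl:
  assumes "finite B" "b \<in> B" shows "b \<in> lspan R T B"
proof -
  have "b = (\<Oplus>c\<in>B. if b = c then c else \<zero>)"
    using assms B by (intro add.finprod_singleton[symmetric]) auto
  also have "\<dots> = (\<Oplus>c\<in>B. (if b = c then \<one> else \<zero>) \<otimes> c)"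
    using B by (intro finsum_cong) (auto simp: simp_implies_def)
  finally show ?thesis
    unfolding lspan_def using subringE(2,3)[OF T] by force
qed

end

text \<open>If \<open>t\<close> is a sum of terms \<open>u \<otimes> c\<close>, then
  \<open>t \<otimes> b\<close> is a sum of terms \<open>u \<otimes> (c \<otimes> b)\<close>, so the
  products \<open>c \<otimes> b\<close>, in this order, generate over \<open>U\<close>. The span of
  \<open>C\<close> has only to contain \<open>T\<close>.\<close>

lemma finite_left_over_trans:
  assumes U: "subring U R" and T: "subring T R"
    and C: "finite C" "C \<subseteq> carrier R" "T \<subseteq> lspan R U C"
    and fin: "finite_left_over R T"
  shows "finite_left_over R U"
proof -
  obtain B where B: "finite B" "B \<subseteq> carrier R" "carrier R \<subseteq> lspan R T B"
    using fin unfolding finite_left_over_iff_lspan by (elim exE conjE)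
  define E where "E = (\<lambda>(c, b). c \<otimes> b) ` (C \<times> B)"
  have E: "finite E" "E \<subseteq> carrier R" using B C by (auto simp: E_def)
  note E' = lspan_carrier[OF U E(2)] lspan_zero[OF U E(2)] lspan_add[OF U E(2)]
  have tb: "t \<otimes> b \<in> lspan R U E" if "t \<in> T" "b \<in> B" for t b
  proof -
    have b: "b \<in> carrier R" using that B by auto
    \<comment> \<open>For fixed \<open>b\<close> the condition on \<open>t\<close> is additive, so
      span induction reduces it to the terms \<open>u \<otimes> c\<close>.\<close>
    have "lspan R U C \<subseteq> {t \<in> carrier R. t \<otimes> b \<in> lspan R U E}"
    proof (rule lspan_minimal[OF C(1)])
      fix u c assume uc: "u \<in> U" "c \<in> C"
      then have "c \<otimes> b \<in> lspan R U E"
        using that by (intro lspan_incl[OF U E(2) E(1)]) (auto simp: E_def)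
      then have "u \<otimes> (c \<otimes> b) \<in> lspan R U E" using lspan_smult[OF U E(2)] uc by blast
      moreover have "u \<in> carrier R" "c \<in> carrier R" using uc C subringE(1)[OF U] by auto
      ultimately show "u \<otimes> c \<in> {t \<in> carrier R. t \<otimes> b \<in> lspan R U E}"
        using b by (simp add: m_assoc)
    qed (use b E' in \<open>auto simp: l_distr\<close>)
    then show ?thesis using that C(3) by auto
  qed
  have "lspan R T B \<subseteq> lspan R U E"
    by (rule lspan_minimal[OF B(1)]) (use E' tb in auto)
  then show ?thesis
    unfolding finite_left_over_iff_lspan by (intro exI[of _ E] conjI E subset_trans[OF B(3)])
qed

text \<open>Reduces commutation statements about a generated ring, or about a difference of
  generators, to the generators.\<close>

lemma centralizer_subring:
  assumes "A \<subseteq> carrier R"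
  shows "subring {s \<in> carrier R. \<forall>a\<in>A. s \<otimes> a = a \<otimes> s} R"
proof (rule subringI)
  fix x y
  assume x: "x \<in> {s \<in> carrier R. \<forall>a\<in>A. s \<otimes> a = a \<otimes> s}" and y: "y \<in> {s \<in> carrier R. \<forall>a\<in>A. s \<otimes> a = a \<otimes> s}"
  have "x \<otimes> y \<otimes> a = a \<otimes> (x \<otimes> y)" if "a \<in> A" for a
  proof -
    have "a \<in> carrier R" using assms that by blast
    then have "x \<otimes> y \<otimes> a = x \<otimes> (y \<otimes> a)" using x y by (simp add: m_assoc)
    also have "\<dots> = x \<otimes> (a \<otimes> y)" using y that by simp
    also have "\<dots> = (x \<otimes> a) \<otimes> y" using x y \<open>a \<in> carrier R\<close> by (simp add: m_assoc)
    also have "\<dots> = (a \<otimes> x) \<otimes> y" using x that by simp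
    finally show ?thesis using x y \<open>a \<in> carrier R\<close> by (simp add: m_assoc)
  qed
  then show "x \<otimes> y \<in> {s \<in> carrier R. \<forall>a\<in>A. s \<otimes> a = a \<otimes> s}" using x y by simp
qed (use assms in \<open>auto simp: subset_iff l_minus r_minus l_distr r_distr\<close>)

end

section \<open>Monic polynomials in a central element\<close>

text \<open>\<open>pow_span R T z d\<close> plays the role of the polynomials in \<open>z\<close> of degree below \<open>d\<close> with
  coefficients in \<open>T\<close>, and \<open>monic R T z d\<close> that of the monic polynomials of degree \<open>d\<close>; the
  degree is not determined by the element, since \<open>z\<close> may be algebraic over \<open>T\<close>.\<close>

definition pow_span :: "('a, 'b) ring_scheme \<Rightarrow> 'a set \<Rightarrow> 'a \<Rightarrow> nat \<Rightarrow> 'a set" where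
  "pow_span R T z d = lspan R T ((\<lambda>i. z [^]\<^bsub>R\<^esub> i) ` {..<d})"

definition monic :: "('a, 'b) ring_scheme \<Rightarrow> 'a set \<Rightarrow> 'a \<Rightarrow> nat \<Rightarrow> 'a set" where
  "monic R T z d = {z [^]\<^bsub>R\<^esub> d \<oplus>\<^bsub>R\<^esub> l | l. l \<in> pow_span R T z d}"

locale ring_subring_central = ring R for R (structure) +
  fixes T z
  assumes T: "subring T R" and z [simp]: "z \<in> carrier R"
    and z_comm: "\<And>t. t \<in> T \<Longrightarrow> t \<otimes> z = z \<otimes> t"
begin

abbreviation "L \<equiv> pow_span R T z"

lemma T_carrier [simp]: "t \<in> T \<Longrightarrow> t \<in> carrier R"
  using subringE(1)[OF T] by auto

lemma pows_carrier: "(\<lambda>i. z [^] i) ` {..<d::nat} \<subseteq> carrier R"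
  by auto

lemma z_pow_comm: "t \<in> T \<Longrightarrow> z [^] (i::nat) \<otimes> t = t \<otimes> z [^] i"
  by (rule group_commutes_pow) (simp_all add: z_comm)

lemmas L_zero = lspan_zero[OF T pows_carrier, folded pow_span_def]
  and L_add = lspan_add[OF T pows_carrier, folded pow_span_def]
  and L_neg = lspan_neg[OF T pows_carrier, folded pow_span_def]
  and L_smult = lspan_smult[OF T pows_carrier, folded pow_span_def]

lemma L_carrier [simp]: "x \<in> L d \<Longrightarrow> x \<in> carrier R"
  using lspan_carrier[OF T pows_carrier, folded pow_span_def] by auto

lemma pow_in_L: "i < d \<Longrightarrow> z [^] i \<in> L d"
  unfolding pow_span_def by (rule lspan_incl[OF T pows_carrier]) auto

lemma L_minimal:
  assumes "M \<subseteq> carrier R" "\<zero> \<in> M"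
    and "\<And>x y. x \<in> M \<Longrightarrow> y \<in> M \<Longrightarrow> x \<oplus> y \<in> M"
    and "\<And>t i. t \<in> T \<Longrightarrow> i < d \<Longrightarrow> t \<otimes> z [^] i \<in> M"
  shows "L d \<subseteq> M"
  unfolding pow_span_def by (rule lspan_minimal) (use assms in auto)

lemma L_subset:
  assumes "\<And>i. i < d \<Longrightarrow> z [^] i \<in> L d'"
  shows "L d \<subseteq> L d'"
  by (rule L_minimal) (use assms L_zero L_add L_smult in auto)

lemma L_mono: "d \<le> d' \<Longrightarrow> L d \<subseteq> L d'"
  by (rule L_subset) (simp add: pow_in_L)

text \<open>Coefficients move past powers of \<open>z\<close>, so exponents add; span induction runs
  over \<open>y\<close> against a single term first, then over \<open>x\<close>. Bounding
  \<open>c\<close> through the exponents avoids the truncated subtraction in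
  \<open>a + b - 1\<close>.\<close>

lemma L_mult:
  assumes "\<And>i j. i < a \<Longrightarrow> j < b \<Longrightarrow> i + j < c" "x \<in> L a" "y \<in> L b"
  shows "x \<otimes> y \<in> L c"
proof -
  have 1: "L b \<subseteq> {y \<in> carrier R. (t \<otimes> z [^] i) \<otimes> y \<in> L c}" if t: "t \<in> T" and i: "i < a" for t i
  proof (rule L_minimal)
    fix s j assume s: "s \<in> T" and j: "j < b"
    have "(t \<otimes> z [^] i) \<otimes> (s \<otimes> z [^] j) = t \<otimes> (z [^] i \<otimes> s) \<otimes> z [^] j"
      using s t by (simp add: m_assoc)
    also have "\<dots> = (t \<otimes> s) \<otimes> z [^] (i + j)"
      using s t by (simp add: m_assoc z_pow_comm nat_pow_mult)
    also have "\<dots> \<in> L c"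
      using s t i j assms(1) by (intro L_smult pow_in_L) (auto simp: subringE(6)[OF T])
    finally show "s \<otimes> z [^] j \<in> {y \<in> carrier R. (t \<otimes> z [^] i) \<otimes> y \<in> L c}"
      using s by simp
  qed (use t in \<open>auto simp: r_distr L_zero intro: L_add\<close>)
  have "L a \<subseteq> {x \<in> carrier R. x \<otimes> y \<in> L c}"
    by (rule L_minimal) (use 1 assms(3) in \<open>auto simp: l_distr L_zero intro: L_add\<close>)
  then show ?thesis using assms(2) by auto
qed

lemma monic_in_L: "p \<in> monic R T z d \<Longrightarrow> d < d' \<Longrightarrow> p \<in> L d'"
  using L_mono[of d d'] pow_in_L[of d d'] by (auto simp: monic_def intro!: L_add)

lemma monic_pow: "z [^] d \<in> monic R T z d"
  unfolding monic_def using L_zero by force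

lemma monic_add:
  assumes "t \<in> T" "0 < d" shows "z [^] d \<oplus> t \<in> monic R T z d"
proof -
  \<comment> \<open>A constant is a term of exponent 0, which lies below degree \<open>d\<close>
    only because \<open>0 < d\<close>.\<close>
  have "t \<otimes> z [^] (0::nat) \<in> L d" using assms by (intro L_smult pow_in_L)
  then show ?thesis unfolding monic_def using assms by auto
qed

lemma monic_mult:
  assumes "p \<in> monic R T z a" "q \<in> monic R T z b"
  shows "p \<otimes> q \<in> monic R T z (a + b)"
proof -
  obtain l m where l: "l \<in> L a" "p = z [^] a \<oplus> l" and m: "m \<in> L b" "q = z [^] b \<oplus> m"
    using assms unfolding monic_def by blast
  have "p \<otimes> q = z [^] (a + b) \<oplus> (z [^] a \<otimes> m \<oplus> l \<otimes> q)"
    using l m by (simp add: l_distr r_distr nat_pow_mult[symmetric] a_ac)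
  \<comment> \<open>Bounds in \<open>L\<close> are strict: an element of degree \<open>a\<close>
    lies in \<open>L (Suc a)\<close>, and its product with one of degree below \<open>b\<close>
    stays below \<open>a + b\<close>.\<close>
  moreover have "z [^] a \<otimes> m \<in> L (a + b)"
    by (rule L_mult[of "Suc a" b]) (use m in \<open>auto intro: pow_in_L\<close>)
  moreover have "l \<otimes> q \<in> L (a + b)"
    by (rule L_mult[of a "Suc b"]) (use l assms in \<open>auto intro: monic_in_L\<close>)
  ultimately show ?thesis unfolding monic_def using L_add by blast
qed

lemma monic_power:
  assumes "p \<in> monic R T z a" shows "p [^] (i::nat) \<in> monic R T z (i * a)"
proof (induction i)
  case 0
  then show ?case using monic_pow[of 0] by simp
next
  case (Suc i)
  then show ?case using monic_mult[OF Suc assms] by (simp add: add.commute)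
qed

lemma monic_mono_prod:
  assumes "\<And>i. i < m \<Longrightarrow> x i \<in> monic R T z (d i)"
  shows "mono_prod R x m e \<in> monic R T z (\<Sum>i<m. e i * d i)"
  using assms
proof (induction m)
  case 0
  then show ?case using monic_pow[of 0] by simp
next
  case (Suc m)
  then show ?case using monic_mult[OF _ monic_power] by simp
qed

text \<open>The assumption is a monic equation of degree \<open>W\<close> for \<open>z\<close> over
  \<open>T\<close>. It reduces every power of \<open>z\<close> to those below \<open>W\<close>, so
  \<open>L W\<close> is the whole ring generated by \<open>T\<close> and \<open>z\<close>.\<close>

lemma L_subring:
  assumes W: "z [^] W \<in> L W"
  shows "subring (L W) R" and "T \<subseteq> L W" and "z [^] (j::nat) \<in> L W"
proof -
  have *: "z [^] j \<in> L W" for j :: nat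
  proof (induction j)
    case 0
    \<comment> \<open>For \<open>W = 0\<close> the assumption is literally the claim.\<close>
    then show ?case using W pow_in_L[of 0 W] by (cases "W = 0") auto
  next
    case (Suc j)
    \<comment> \<open>Multiplication by \<open>z\<close> raises the degree bound by one, and the
      only new power, \<open>z [^] W\<close>, is reduced by the assumption.\<close>
    have "z [^] j \<otimes> z [^] (1::nat) \<in> L (Suc W)"
      by (rule L_mult[of W 2, OF _ Suc pow_in_L]) auto
    moreover have "L (Suc W) \<subseteq> L W"
      by (rule L_subset) (use W in \<open>auto simp: less_Suc_eq intro: pow_in_L\<close>)
    ultimately show ?case by auto
  qed
  then show "z [^] j \<in> L W" .
  have sub: "L d \<subseteq> L W" for d by (rule L_subset) (rule *)
  have one: "\<one> \<in> L W" using *[of 0] by simp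
  then show "T \<subseteq> L W" using L_smult[of _ \<one>] by fastforce
  show "subring (L W) R"
  proof (rule subringI)
    fix x y assume "x \<in> L W" "y \<in> L W"
    then have "x \<otimes> y \<in> L (W + W)" by (intro L_mult[of W W]) auto
    then show "x \<otimes> y \<in> L W" using sub by blast
  qed (use one L_add L_neg in auto)
qed

end

section \<open>Noether normalization\<close>

text \<open>Uniqueness of digits in base \<open>N\<close>, the least significant one at index
  \<open>m - 1\<close>; the induction splits that digit off modulo \<open>N\<close>. It will
  separate the degrees of distinct monomials.\<close>

lemma sum_base_inj:
  fixes e e' :: "nat \<Rightarrow> nat"
  assumes "\<And>i. i < m \<Longrightarrow> e i < N" "\<And>i. i < m \<Longrightarrow> e' i < N"
    and "(\<Sum>i<m. e i * N ^ (m - Suc i)) = (\<Sum>i<m. e' i * N ^ (m - Suc i))"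
  shows "\<forall>i<m. e i = e' i"
  using assms
proof (induction m)
  case 0
  then show ?case by simp
next
  case (Suc m)
  have step: "(\<Sum>i<Suc m. f i * N ^ (Suc m - Suc i)) = N * (\<Sum>i<m. f i * N ^ (m - Suc i)) + f m"
    for f :: "nat \<Rightarrow> nat"
  proof -
    have "(\<Sum>i<m. f i * N ^ (Suc m - Suc i)) = (\<Sum>i<m. N * (f i * N ^ (m - Suc i)))"
      by (intro sum.cong) (auto simp: Suc_diff_Suc[symmetric] simp del: diff_Suc_Suc)
    then show ?thesis by (simp add: sum_distrib_left)
  qed
  define a b where "a = (\<Sum>i<m. e i * N ^ (m - Suc i))" and "b = (\<Sum>i<m. e' i * N ^ (m - Suc i))"
  have eq: "N * a + e m = N * b + e' m"
    using Suc.prems(3) unfolding step a_def b_def .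
  have N: "e m < N" "e' m < N" using Suc.prems by auto
  have "e m = (N * a + e m) mod N" "e' m = (N * b + e' m) mod N" using N by auto
  then have "e m = e' m" using eq by simp
  have "a = b" using eq \<open>e m = e' m\<close> N by simp
  then have "\<forall>i<m. e i = e' i"
    unfolding a_def b_def by (intro Suc.IH Suc.prems(1,2)) auto
  with \<open>e m = e' m\<close> show ?case by (simp add: less_Suc_eq)
qed

section \<open>Central tuples over a division ring and their relations\<close>

text \<open>Scalars enter the argument through products and inverses, hence this choice of axioms
  for \<open>\<iota>\<close>. With \<open>nontrivial\<close>, a nonzero scalar has a nonzero
  image.\<close>

locale ring_over_division_ring = ring R for R (structure) +
  fixes \<iota> :: "'d::division_ring \<Rightarrow> 'a"
  assumes \<iota>_closed [simp]: "\<iota> d \<in> carrier R"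
    and \<iota>_zero [simp]: "\<iota> 0 = \<zero>"
    and \<iota>_one [simp]: "\<iota> 1 = \<one>"
    and \<iota>_mult: "\<iota> (c * d) = \<iota> c \<otimes> \<iota> d"
    and nontrivial: "\<one> \<noteq> \<zero>"
begin

definition central_tuple :: "nat \<Rightarrow> (nat \<Rightarrow> 'a) \<Rightarrow> bool" where
  "central_tuple m x \<longleftrightarrow> (\<forall>i<m. x i \<in> carrier R) \<and>
     (\<forall>i<m. \<forall>j<m. x i \<otimes> x j = x j \<otimes> x i) \<and>
     (\<forall>i<m. \<forall>d. x i \<otimes> \<iota> d = \<iota> d \<otimes> x i)"

abbreviation gen :: "nat \<Rightarrow> (nat \<Rightarrow> 'a) \<Rightarrow> 'a set" where
  "gen m x \<equiv> generate_ring R (range \<iota> \<union> x ` {..<m})"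

lemma gens_carrier: "central_tuple m x \<Longrightarrow> range \<iota> \<union> x ` {..<m} \<subseteq> carrier R"
  by (auto simp: central_tuple_def)

lemma gen_subring: "central_tuple m x \<Longrightarrow> subring (gen m x) R"
  by (rule generate_ring_is_subring[OF gens_carrier])

lemma mono_prod_closed: "central_tuple m x \<Longrightarrow> k \<le> m \<Longrightarrow> mono_prod R x k e \<in> carrier R"
  by (induction k) (auto simp: central_tuple_def)

text \<open>The zero vector is the only exponent vector, so a relation reads
  \<open>\<iota> d = \<zero>\<close> for one scalar \<open>d\<close>; if \<open>d\<close> were
  nonzero, multiplying by the image of its inverse would give
  \<open>\<one> = \<zero>\<close>.\<close>

lemma indep_zero: "left_alg_indep R \<iota> 0 x"
  unfolding left_alg_indep_def
proof (intro allI impI ballI, elim conjE)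
  fix F c e
  assume F: "F \<subseteq> {e. \<forall>i\<ge>0::nat. e i = (0::nat)}" and e: "e \<in> F"
    and sum: "(\<Oplus>e\<in>F. \<iota> (c e) \<otimes> mono_prod R x 0 e) = \<zero>"
  have "f = e" if "f \<in> F" for f
  proof -
    have "\<forall>i. f i = 0" "\<forall>i. e i = 0" using F e that by auto
    then show ?thesis by (simp add: fun_eq_iff)
  qed
  then have "F = {e}" using e by blast
  then have "\<iota> (c e) = \<zero>" using sum by simp
  then have "\<iota> (inverse (c e) * c e) = \<zero>" by (simp add: \<iota>_mult)
  then show "c e = 0" using nontrivial by (cases "c e = 0") auto
qed

text \<open>Discarding the zero coefficients of a relation leaves only invertible ones, so whichever
  monomial turns out to be the top one can be solved for.\<close>

lemma dependent_relation:
  assumes x: "central_tuple m x" and dep: "\<not> left_alg_indep R \<iota> m x"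
  obtains G c where "finite G" "G \<noteq> {}" "G \<subseteq> {e. \<forall>i\<ge>m. e i = 0}" "\<And>e. e \<in> G \<Longrightarrow> c e \<noteq> 0"
    and "(\<Oplus>e\<in>G. \<iota> (c e) \<otimes> mono_prod R x m e) = \<zero>"
proof -
  obtain F c e\<^sub>0 where F: "finite F" "F \<subseteq> {e. \<forall>i\<ge>m. e i = 0}" "e\<^sub>0 \<in> F" "c e\<^sub>0 \<noteq> 0"
    and sum: "(\<Oplus>e\<in>F. \<iota> (c e) \<otimes> mono_prod R x m e) = \<zero>"
    using dep unfolding left_alg_indep_def by blast
  have "(\<Oplus>e\<in>{e \<in> F. c e \<noteq> 0}. \<iota> (c e) \<otimes> mono_prod R x m e)
      = (\<Oplus>e\<in>F. \<iota> (c e) \<otimes> mono_prod R x m e)"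
    by (rule add.finprod_mono_neutral_cong_left)
      (use F(1) mono_prod_closed[OF x] in auto)
  then show ?thesis
    using F sum by (intro that[of "{e \<in> F. c e \<noteq> 0}" c]) auto
qed

text \<open>Nagata's substitution \<open>x i = y i + z ^ (N ^ (k - i))\<close> with \<open>z = x k\<close>: for \<open>N\<close> larger than
  all exponents of a nontrivial relation, its monomials become monic in \<open>z\<close> of pairwise distinct
  degrees.  Dividing by the coefficient of the top one expresses a power of \<open>z\<close> through lower ones.\<close>

lemma nagata:
  assumes x: "central_tuple (Suc k) x" and dep: "\<not> left_alg_indep R \<iota> (Suc k) x"
  obtains y C where "central_tuple k y" "finite C" "C \<subseteq> carrier R"
    "gen (Suc k) x \<subseteq> lspan R (gen k y) C"
proof -
  obtain G c where G: "finite G" "G \<noteq> {}" "G \<subseteq> {e. \<forall>i\<ge>Suc k. e i = 0}"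
    and c: "\<And>e. e \<in> G \<Longrightarrow> c e \<noteq> 0"
    and rel: "(\<Oplus>e\<in>G. \<iota> (c e) \<otimes> mono_prod R x (Suc k) e) = \<zero>"
    using dependent_relation[OF x dep] by blast
  have "finite ((\<lambda>(e, i). e i) ` (G \<times> {..<Suc k}))" using G by auto
  then obtain N where "\<forall>d\<in>(\<lambda>(e, i). e i) ` (G \<times> {..<Suc k}). d < N"
    unfolding finite_nat_set_iff_bounded by blast
  then have N: "e i < N" if "e \<in> G" "i < Suc k" for e i using that by auto
  have "N > 0" using G(2) N by fastforce
  define z where "z = x k"
  define y where "y = (\<lambda>i. x i \<ominus> z [^] (N ^ (k - i)))"
  have xc: "x i \<in> carrier R" if "i < Suc k" for i using x that by (auto simp: central_tuple_def)
  have zc: "z \<in> carrier R" by (auto simp: z_def xc)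
  \<comment> \<open>\<open>y i\<close> is built from \<open>x i\<close> and a power of
    \<open>x k\<close>, so it commutes with whatever all the \<open>x j\<close> commute with. This
    is used first with \<open>a\<close> an \<open>x j\<close>, then with \<open>a\<close> a
    \<open>y j\<close> or a scalar.\<close>
  have y_centralizes: "y i \<otimes> a = a \<otimes> y i"
    if i: "i < k" and a: "a \<in> carrier R" "\<And>j. j < Suc k \<Longrightarrow> x j \<otimes> a = a \<otimes> x j" for i a
  proof -
    have "subring {s \<in> carrier R. \<forall>a\<in>{a}. s \<otimes> a = a \<otimes> s} R"
      by (rule centralizer_subring) (use a in auto)
    from subringE(5,7)[OF this] show ?thesis
      using i a xc zc group_commutes_pow[of z a] by (auto simp: y_def z_def minus_eq)
  qed
  have y_carrier: "y i \<in> carrier R" if "i < k" for i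
    using that xc zc by (auto simp: y_def)
  have yx: "y i \<otimes> x j = x j \<otimes> y i" if "i < k" "j < Suc k" for i j
    by (rule y_centralizes) (use that x in \<open>auto simp: central_tuple_def\<close>)
  have y: "central_tuple k y"
    unfolding central_tuple_def
  proof (intro conjI allI impI)
    fix i j d assume i: "i < k"
    show "y i \<in> carrier R" by (rule y_carrier[OF i])
    show "y i \<otimes> y j = y j \<otimes> y i" if j: "j < k"
      by (rule y_centralizes[OF i y_carrier[OF j] yx[OF j, symmetric]])
    show "y i \<otimes> \<iota> d = \<iota> d \<otimes> y i"
      by (rule y_centralizes[OF i \<iota>_closed]) (use x in \<open>simp add: central_tuple_def\<close>)
  qed
  define T where "T = gen k y"
  \<comment> \<open>The generators of \<open>T\<close> commute with \<open>z\<close>, hence so does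
    all of \<open>T\<close>, which makes the results on monic elements available.\<close>
  have "range \<iota> \<union> y ` {..<k} \<subseteq> {s \<in> carrier R. \<forall>a\<in>{z}. s \<otimes> a = a \<otimes> s}"
    using y_carrier yx[of _ k] x by (fastforce simp: z_def central_tuple_def)
  then have "T \<subseteq> {s \<in> carrier R. \<forall>a\<in>{z}. s \<otimes> a = a \<otimes> s}"
    unfolding T_def using zc
    by (intro generate_ring_min_subring1[OF gens_carrier[OF y] centralizer_subring]) auto
  then have "t \<otimes> z = z \<otimes> t" if "t \<in> T" for t using that by blast
  with gen_subring[OF y] zc interpret ring_subring_central R T z
    by (intro ring_subring_central.intro ring_subring_central_axioms.intro ring_axioms)
      (simp_all only: T_def)
  have \<iota>T: "\<iota> d \<in> T" for d unfolding T_def by (auto intro: generate_ring.incl)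
  have yT: "y i \<in> T" if "i < k" for i using that unfolding T_def by (auto intro: generate_ring.incl)
  have x_y: "x i = z [^] (N ^ (k - i)) \<oplus> y i" if "i < k" for i
    using that xc[of i] zc by (simp add: y_def minus_eq a_comm[of "x i"] r_neg2)
  \<comment> \<open>The weights are \<open>N ^ k\<close>, ..., \<open>N\<close>, \<open>1\<close>;
    the last belongs to \<open>x k\<close>, which is \<open>z\<close> itself.\<close>
  have x_monic: "x i \<in> monic R T z (N ^ (Suc k - Suc i))" if "i < Suc k" for i
  proof (cases "i = k")
    case True
    then show ?thesis using monic_pow[of 1] zc by (simp add: z_def)
  next
    case False
    then show ?thesis using that x_y[of i] monic_add[OF yT, of i "N ^ (k - i)"] \<open>N > 0\<close> by simp
  qed
  define w where "w = (\<lambda>e. \<Sum>i<Suc k. e i * N ^ (Suc k - Suc i))"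
  define p where "p = mono_prod R x (Suc k)"
  have mono: "p e \<in> monic R T z (w e)" for e
    unfolding w_def p_def by (rule monic_mono_prod[OF x_monic])
  have w_inj: "inj_on w G"
  proof (rule inj_onI)
    fix e e' assume e: "e \<in> G" "e' \<in> G" and "w e = w e'"
    then have "\<forall>i<Suc k. e i = e' i" unfolding w_def by (intro sum_base_inj) (auto simp: N)
    moreover have "\<forall>i\<ge>Suc k. e i = 0" "\<forall>i\<ge>Suc k. e' i = 0" using e G(3) by blast+
    ultimately show "e = e'" by (metis ext not_le)
  qed
  \<comment> \<open>Since \<open>w\<close> is injective on \<open>G\<close>, exactly one vector
    \<open>e\<close> has maximal weight, and all other terms of the relation lie in
    \<open>L (w e)\<close>.\<close>
  have "Max (w ` G) \<in> w ` G" using G(1,2) by simp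
  then obtain e where e: "e \<in> G" "Max (w ` G) = w e" by auto
  have less: "w e' < w e" if "e' \<in> G - {e}" for e'
  proof -
    have "w e' \<le> w e" using that G(1) e(2)[symmetric] by simp
    moreover have "w e' \<noteq> w e" using that e(1) w_inj by (auto dest: inj_onD)
    ultimately show ?thesis by simp
  qed
  have pc: "p e \<in> carrier R" for e unfolding p_def by (rule mono_prod_closed[OF x]) simp
  define r where "r = (\<Oplus>e\<in>G - {e}. \<iota> (c e) \<otimes> p e)"
  have r: "r \<in> L (w e)" unfolding r_def
  proof (rule finsum_in_closed_set)
    show "(\<lambda>e. \<iota> (c e) \<otimes> p e) \<in> G - {e} \<rightarrow> L (w e)"
      using less \<iota>T mono by (blast intro: L_smult monic_in_L)
  qed (use G(1) in \<open>auto intro: L_zero L_add\<close>)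
  have "(\<Oplus>e\<in>insert e (G - {e}). \<iota> (c e) \<otimes> p e) = \<zero>"
    using rel e(1) by (simp only: insert_Diff p_def)
  then have "\<iota> (c e) \<otimes> p e \<oplus> r = \<zero>"
    unfolding r_def using G(1) pc by (subst (asm) finsum_insert) auto
  then have "\<iota> (c e) \<otimes> p e = \<ominus> r"
    by (rule minus_equality[symmetric]) (use r pc in auto)
  \<comment> \<open>Dividing on the left by the top coefficient is harmless because
    \<open>L (w e)\<close> is closed under left multiplication by \<open>T\<close>, which contains
    the scalars.\<close>
  then have "\<iota> (inverse (c e)) \<otimes> (\<iota> (c e) \<otimes> p e) \<in> L (w e)"
    using L_smult[OF \<iota>T L_neg[OF r]] by simp
  moreover have "\<iota> (inverse (c e)) \<otimes> (\<iota> (c e) \<otimes> p e) = p e"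
    using c[OF e(1)] pc by (simp add: m_assoc[symmetric] \<iota>_mult[symmetric])
  ultimately have p_L: "p e \<in> L (w e)" by simp
  \<comment> \<open>\<open>p e\<close> is monic of degree \<open>w e\<close> and also lies in the
    span of the lower powers; comparing the two gives the monic equation for \<open>z\<close> that
    \<open>L_subring\<close> requires.\<close>
  obtain l where l: "l \<in> L (w e)" "p e = z [^] w e \<oplus> l"
    using mono[of e] unfolding monic_def by blast
  have "z [^] w e = p e \<oplus> \<ominus> l"
    using l by (simp add: a_assoc r_neg)
  then have "z [^] w e \<in> L (w e)" using p_L l(1) by (simp add: L_add L_neg)
  note L = L_subring[OF this]
  have "x i \<in> L (w e)" if "i < Suc k" for i
  proof (cases "i = k")
    case True
    then show ?thesis using L(3)[of 1] zc by (simp add: z_def)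
  next
    case False
    then show ?thesis using that x_y[of i] L(2,3) yT[of i] by (auto intro: L_add)
  qed
  \<comment> \<open>The subring \<open>L (w e)\<close> contains all generators; the finite set
    \<open>C\<close> consists of the powers of \<open>z\<close> below \<open>w e\<close>.\<close>
  then have "gen (Suc k) x \<subseteq> L (w e)"
    using L(2) \<iota>T by (intro generate_ring_min_subring1[OF gens_carrier[OF x] L(1)]) auto
  then show ?thesis
    by (intro that[OF y _ pows_carrier[of "w e"]]) (simp_all only: pow_span_def T_def finite_imageI finite_lessThan)
qed

text \<open>Induction on the length of the tuple: an independent tuple is a witness itself, a
  dependent one is replaced by a shorter one through \<open>nagata\<close>, and finiteness is passed
  on by transitivity. The empty tuple is always independent.\<close>

theorem centrally_normalizable_if_finite:
  assumes "central_tuple m x" "finite_left_over R (gen m x)"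
  shows "centrally_normalizable R \<iota>"
  using assms
proof (induction m arbitrary: x)
  case 0
  then show ?case
    unfolding centrally_normalizable_def using indep_zero[of x] by (intro exI[of _ 0] exI[of _ x]) simp
next
  case (Suc k)
  show ?case
  proof (cases "left_alg_indep R \<iota> (Suc k) x")
    case True
    then show ?thesis
      unfolding centrally_normalizable_def using Suc.prems
      by (intro exI[of _ "Suc k"] exI[of _ x]) (simp add: central_tuple_def)
  next
    case False
    obtain y C where y: "central_tuple k y" and C: "finite C" "C \<subseteq> carrier R"
      "gen (Suc k) x \<subseteq> lspan R (gen k y) C"
      using nagata[OF Suc.prems(1) False] by blast
    have "finite_left_over R (gen k y)"
      by (rule finite_left_over_trans[OF gen_subring[OF y] gen_subring[OF Suc.prems(1)] C Suc.prems(2)])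
    then show ?thesis using Suc.IH y by blast
  qed
qed

end

section \<open>Polynomial rings\<close>

text \<open>Transports generation of the polynomial ring to its quotient.\<close>

lemma (in ring_hom_ring) image_generate_ring:
  assumes "H \<subseteq> carrier R"
  shows "h ` generate_ring R H \<subseteq> generate_ring S (h ` H)"
proof clarify
  fix p assume "p \<in> generate_ring R H"
  then show "h p \<in> generate_ring S (h ` H)"
  proof (induction rule: generate_ring.induct)
    case one
    then show ?case using generate_ring.one[of S] by simp
  next
    case (incl p)
    then show ?case by (auto intro: generate_ring.incl)
  next
    case (a_inv p)
    then show ?case using generate_ring.a_inv[of "h p" S]
      by (simp add: R.generate_ring_in_carrier[OF assms])
  next
    case (eng_add p q)
    then show ?case using generate_ring.eng_add[of "h p" S _ "h q"]
      by (simp add: R.generate_ring_in_carrier[OF assms])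
  next
    case (eng_mult p q)
    then show ?case using generate_ring.eng_mult[of "h p" S _ "h q"]
      by (simp add: R.generate_ring_in_carrier[OF assms])
  qed
qed

lemma poly_ring_n_simps [simp]:
  "p \<in> carrier (poly_ring_n n) \<longleftrightarrow> (\<forall>m\<in>Poly_Mapping.keys p. Poly_Mapping.keys m \<subseteq> {..<n})"
  "p \<otimes>\<^bsub>poly_ring_n n\<^esub> q = p * q" "\<one>\<^bsub>poly_ring_n n\<^esub> = 1"
  "p \<oplus>\<^bsub>poly_ring_n n\<^esub> q = p + q" "\<zero>\<^bsub>poly_ring_n n\<^esub> = 0"
  by (simp_all add: poly_ring_n_def)

lemma poly_ring_n_ring: "ring (poly_ring_n n :: ((nat \<Rightarrow>\<^sub>0 nat) \<Rightarrow>\<^sub>0 'd::division_ring) ring)"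
proof (intro ringI abelian_groupI monoidI)
  fix p :: "(nat \<Rightarrow>\<^sub>0 nat) \<Rightarrow>\<^sub>0 'd"
  assume "p \<in> carrier (poly_ring_n n)"
  then show "\<exists>q\<in>carrier (poly_ring_n n). q \<oplus>\<^bsub>poly_ring_n n\<^esub> p = \<zero>\<^bsub>poly_ring_n n\<^esub>"
    by (intro bexI[of _ "- p"]) auto
next
  fix p q :: "(nat \<Rightarrow>\<^sub>0 nat) \<Rightarrow>\<^sub>0 'd"
  assume p: "p \<in> carrier (poly_ring_n n)" and q: "q \<in> carrier (poly_ring_n n)"
  then show "p \<oplus>\<^bsub>poly_ring_n n\<^esub> q \<in> carrier (poly_ring_n n)"
    using Poly_Mapping.keys_add[of p q] by fastforce
  show "p \<otimes>\<^bsub>poly_ring_n n\<^esub> q \<in> carrier (poly_ring_n n)"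
    unfolding poly_ring_n_simps
  proof
    fix m assume "m \<in> Poly_Mapping.keys (p * q)"
    then obtain a b where "m = a + b" "a \<in> Poly_Mapping.keys p" "b \<in> Poly_Mapping.keys q"
      using keys_mult[of p q] by blast
    then show "Poly_Mapping.keys m \<subseteq> {..<n}"
      using p q Poly_Mapping.keys_add[of a b] by fastforce
  qed
qed (auto simp: algebra_simps)

text \<open>General in its types because it serves on two levels: a polynomial is the sum of its
  terms, and an exponent vector is the sum of its one-variable parts.\<close>

lemma sum_monomials:
  fixes p :: "'a \<Rightarrow>\<^sub>0 'b::comm_monoid_add"
  shows "(\<Sum>m\<in>Poly_Mapping.keys p. Poly_Mapping.single m (Poly_Mapping.lookup p m)) = p"
  by (rule poly_mapping_eqI)
    (simp add: lookup_sum lookup_single when_def sum.delta in_keys_iff)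

text \<open>Products of \<open>single\<close> terms add exponents, so powers of variables, then
  monomials, then terms with a coefficient, and finally their sums are reached.\<close>

lemma poly_ring_n_generated:
  "carrier (poly_ring_n n :: ((nat \<Rightarrow>\<^sub>0 nat) \<Rightarrow>\<^sub>0 'd::division_ring) ring) \<subseteq> generate_ring (poly_ring_n n)
     (range const_poly \<union> (\<lambda>i. Poly_Mapping.single (Poly_Mapping.single i 1) 1) ` {..<n})"
    (is "_ \<subseteq> ?G")
proof
  interpret ring "poly_ring_n n :: ((nat \<Rightarrow>\<^sub>0 nat) \<Rightarrow>\<^sub>0 'd::division_ring) ring"
    by (rule poly_ring_n_ring)
  fix p :: "(nat \<Rightarrow>\<^sub>0 nat) \<Rightarrow>\<^sub>0 'd" assume p: "p \<in> carrier (poly_ring_n n)"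
  have one: "1 \<in> ?G" using generate_ring.one[of "poly_ring_n n"] by simp
  have zero: "0 \<in> ?G" using zero_in_generate by simp
  have add: "a + b \<in> ?G" if "a \<in> ?G" "b \<in> ?G" for a b
    using generate_ring.eng_add[OF that] by simp
  have mult: "a * b \<in> ?G" if "a \<in> ?G" "b \<in> ?G" for a b
    using generate_ring.eng_mult[OF that] by simp
  have pow: "Poly_Mapping.single (Poly_Mapping.single i j) 1 \<in> ?G" if "i < n" for i j
  proof (induction j)
    case 0
    then show ?case using one by simp
  next
    case (Suc j)
    have "Poly_Mapping.single (Poly_Mapping.single i 1) 1 \<in> ?G"
      using that by (intro generate_ring.incl) auto
    from mult[OF this Suc] show ?case by (simp add: mult_single single_add[symmetric])
  qed
  have mon: "Poly_Mapping.single (\<Sum>i\<in>A. Poly_Mapping.single i (m i)) 1 \<in> ?G"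
    if "finite A" "A \<subseteq> {..<n}" for A m
    using that
  proof (induction A rule: finite_induct)
    case empty
    then show ?case using one by simp
  next
    case (insert i A)
    then have "Poly_Mapping.single (Poly_Mapping.single i (m i)) 1
        * Poly_Mapping.single (\<Sum>i\<in>A. Poly_Mapping.single i (m i)) 1 \<in> ?G"
      by (intro mult pow) auto
    then show ?case using insert by (simp add: mult_single)
  qed
  have term_in: "Poly_Mapping.single m (Poly_Mapping.lookup p m) \<in> ?G" if "m \<in> Poly_Mapping.keys p" for m
  proof -
    have "const_poly (Poly_Mapping.lookup p m) * Poly_Mapping.single m 1 \<in> ?G"
      using mon[of "Poly_Mapping.keys m" "Poly_Mapping.lookup m"] that p
      by (intro mult) (auto intro: generate_ring.incl simp: sum_monomials)
    then show ?thesis by (simp add: const_poly_def mult_single)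
  qed
  have "(\<Sum>m\<in>A. Poly_Mapping.single m (Poly_Mapping.lookup p m)) \<in> ?G"
    if "A \<subseteq> Poly_Mapping.keys p" for A
    using that by (induction A rule: infinite_finite_induct) (simp_all add: zero add term_in del: One_nat_def)
  from this[OF subset_refl]
  show "p \<in> ?G" by (simp add: sum_monomials)
qed

text \<open>The classes of the variables form a central tuple, since multiplying monomials adds
  exponents and their coefficients are 1. As the quotient map is onto, they generate the quotient
  together with the scalars.\<close>

theorem theorem4p3:
  fixes n :: nat and I :: "((nat \<Rightarrow>\<^sub>0 nat) \<Rightarrow>\<^sub>0 'd::division_ring) set"
  assumes "ideal I (poly_ring_n n)"
    and "I \<noteq> carrier (poly_ring_n n)"
  shows "centrally_normalizable ((poly_ring_n n) Quot I)
           (\<lambda>d. I +>\<^bsub>poly_ring_n n\<^esub> const_poly d)"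
proof -
  let ?P = "poly_ring_n n :: ((nat \<Rightarrow>\<^sub>0 nat) \<Rightarrow>\<^sub>0 'd) ring"
  interpret ideal I ?P by (rule assms(1))
  let ?Q = "?P Quot I"
  let ?h = "\<lambda>p. I +>\<^bsub>?P\<^esub> p"
  let ?x = "\<lambda>i. Poly_Mapping.single (Poly_Mapping.single i (1::nat)) (1::'d)"
  interpret h: ring_hom_ring ?P ?Q ?h by (rule rcos_ring_hom_ring)
  have const: "const_poly d \<in> carrier ?P" for d :: 'd
    by (auto simp: const_poly_def)
  have var: "?x i \<in> carrier ?P" if "i < n" for i
    using that by simp
  have h_mult: "?h (p * q) = ?h p \<otimes>\<^bsub>?Q\<^esub> ?h q" if "p \<in> carrier ?P" "q \<in> carrier ?P" for p q
    using h.hom_mult[OF that] by simp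
  have "\<one>\<^bsub>?P\<^esub> \<notin> I" using one_imp_carrier assms(2) by blast
  \<comment> \<open>Properness of \<open>I\<close> enters here: the class of 1 contains 1, while the
    zero class is \<open>I\<close>.\<close>
  then have nontrivial: "\<one>\<^bsub>?Q\<^esub> \<noteq> \<zero>\<^bsub>?Q\<^esub>"
    using a_rcos_self[of "\<one>\<^bsub>?P\<^esub>"] by (auto simp: FactRing_def)
  interpret Q: ring_over_division_ring ?Q "\<lambda>d. ?h (const_poly d)"
  proof
    show "?h (const_poly 0) = \<zero>\<^bsub>?Q\<^esub>" using h.hom_zero by (simp add: const_poly_def)
    show "?h (const_poly 1) = \<one>\<^bsub>?Q\<^esub>" using h.hom_one by (simp add: const_poly_def)
    show "?h (const_poly (c * d)) = ?h (const_poly c) \<otimes>\<^bsub>?Q\<^esub> ?h (const_poly d)" for c d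
      using h_mult[OF const[of c] const[of d]] by (simp add: const_poly_def mult_single)
  qed (use const nontrivial in auto)
  have tuple: "Q.central_tuple n (\<lambda>i. ?h (?x i))"
    unfolding Q.central_tuple_def
    using h.hom_closed[OF var] const var
    by (simp add: h_mult[symmetric] const_poly_def mult_single add.commute del: poly_ring_n_simps(1))
  let ?H = "range const_poly \<union> ?x ` {..<n}"
  have "carrier ?Q = ?h ` carrier ?P" by (auto simp: FactRing_def A_RCOSETS_def')
  also have "\<dots> \<subseteq> ?h ` generate_ring ?P ?H" using poly_ring_n_generated by (rule image_mono)
  also have "\<dots> \<subseteq> generate_ring ?Q (?h ` ?H)"
    by (rule h.image_generate_ring) (use const var in auto)
  also have "?h ` ?H = range (\<lambda>d. ?h (const_poly d)) \<union> (\<lambda>i. ?h (?x i)) ` {..<n}"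
    by (simp add: image_Un image_image)
  finally have gen: "carrier ?Q \<subseteq> Q.gen n (\<lambda>i. ?h (?x i))" .
  \<comment> \<open>The generated ring is the whole quotient, so the single module generator 1
    suffices, with \<open>s\<close> as its own coefficient.\<close>
  have "finite_left_over ?Q (Q.gen n (\<lambda>i. ?h (?x i)))"
    unfolding finite_left_over_def
    by (rule exI[of _ "{\<one>\<^bsub>?Q\<^esub>}"]) (use gen in \<open>auto intro!: exI[of _ "\<lambda>_. s" for s]\<close>)
  then show ?thesis by (rule Q.centrally_normalizable_if_finite[OF tuple])
qed

end
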